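(* Let $G$ be a connected graph such that $\overline{G}$ is connected. Then $\mathrm{h}_m(G\overline{G})= 2$.
   Context: All graphs are finite, simple and undirected. The complementary prism $G\overline{G}$ of a graph $G$ is obtained from the disjoint union of $G$ and its complement $\overline{G}$ by adding the edges of the perfect matching joining each vertex $u$ of $G$ to its copy $\overline{u}$ in $\overline{G}$. A path is monophonic if it is an induced (chordless) path. A set $S$ of vertices of a graph $H$ is monophonic convex if it contains every vertex of every monophonic path between two vertices of $S$. The monophonic convex hull $[S]_H$ of $S\subseteq V(H)$ is the smallest monophonic convex set of $H$ containing $S$. A set $S$ is an $m$-hull set of $H$ if $[S]_H=V(H)$; the monophonic hull number $\mathrm{h}_m(H)$ is the minimum cardinality of an $m$-hull set of $H$. *)

theory Defs
  imports "Graph_Theory.Graph_Theory"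
begin

text \<open>
  A finite simple undirected graph is a \<^locale>\<open>pair_graph\<close>: an edge \<open>uv\<close> is represented by
  the two arcs \<open>(u, v)\<close> and \<open>(v, u)\<close>. The library's \<^const>\<open>connected\<close> excludes the null graph.
\<close>

definition complement_graph :: "'a pair_pre_digraph \<Rightarrow> 'a pair_pre_digraph" where
  "complement_graph G = \<lparr> pverts = pverts G,
     parcs = {(u, v). u \<in> pverts G \<and> v \<in> pverts G \<and> u \<noteq> v \<and> (u, v) \<notin> parcs G} \<rparr>"

text \<open>\<open>Inl u\<close> is the vertex \<open>u\<close> of \<open>G\<close>, and \<open>Inr u\<close> is its copy in the complement.\<close>

definition complementary_prism :: "'a pair_pre_digraph \<Rightarrow> ('a + 'a) pair_pre_digraph" where
  "complementary_prism G = \<lparr> pverts = pverts G <+> pverts (complement_graph G),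
     parcs = {(Inl u, Inl v) | u v. (u, v) \<in> parcs G}
           \<union> {(Inr u, Inr v) | u v. (u, v) \<in> parcs (complement_graph G)}
           \<union> {(Inl u, Inr u) | u. u \<in> pverts G}
           \<union> {(Inr u, Inl u) | u. u \<in> pverts G} \<rparr>"

text \<open>
  A path is given by its list of pairwise distinct vertices; a chord would be an edge between two
  vertices that are not consecutive in that list.
\<close>

definition monophonic_path :: "'a pair_pre_digraph \<Rightarrow> 'a list \<Rightarrow> bool" where
  "monophonic_path H p \<longleftrightarrow> vpath p (with_proj H) \<and>
     (\<forall>i < length p. \<forall>j < length p. (p ! i, p ! j) \<in> parcs H \<longrightarrow> j = Suc i \<or> i = Suc j)"

definition monophonic_convex :: "'a pair_pre_digraph \<Rightarrow> 'a set \<Rightarrow> bool" where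
  "monophonic_convex H S \<longleftrightarrow> S \<subseteq> pverts H \<and>
     (\<forall>p. monophonic_path H p \<and> hd p \<in> S \<and> last p \<in> S \<longrightarrow> set p \<subseteq> S)"

definition monophonic_hull :: "'a pair_pre_digraph \<Rightarrow> 'a set \<Rightarrow> 'a set" where
  "monophonic_hull H S = \<Inter>{T. monophonic_convex H T \<and> S \<subseteq> T}"

definition m_hull_set :: "'a pair_pre_digraph \<Rightarrow> 'a set \<Rightarrow> bool" where
  "m_hull_set H S \<longleftrightarrow> S \<subseteq> pverts H \<and> monophonic_hull H S = pverts H"

definition monophonic_hull_number :: "'a pair_pre_digraph \<Rightarrow> nat" where
  "monophonic_hull_number H = (LEAST k. \<exists>S. m_hull_set H S \<and> card S = k)"

lemma pair_graph_complement_graph: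
  assumes "pair_graph G" shows "pair_graph (complement_graph G)"
proof -
  interpret pair_graph G by fact
  have "finite {(u, v). u \<in> pverts G \<and> v \<in> pverts G \<and> u \<noteq> v \<and> (u, v) \<notin> parcs G}"
    by (rule finite_subset[of _ "pverts G \<times> pverts G"]) auto
  then show ?thesis
    by unfold_locales
      (auto simp: complement_graph_def symmetric_def intro!: symI dest: arcs_symmetric)
qed

lemma pair_graph_complementary_prism:
  assumes "pair_graph G" shows "pair_graph (complementary_prism G)"
proof -
  interpret G: pair_graph G by fact
  interpret C: pair_graph "complement_graph G"
    using assms by (rule pair_graph_complement_graph)
  have V: "pverts (complement_graph G) = pverts G"
    by (simp add: complement_graph_def)
  let ?P = "complementary_prism G"
  have wf: "parcs ?P \<subseteq> pverts ?P \<times> pverts ?P"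
    using G.wellformed' C.wellformed' by (auto simp: complementary_prism_def V)
  have fin: "finite (pverts ?P)"
    by (simp add: complementary_prism_def V)
  show ?thesis
  proof unfold_locales
    show "finite (parcs ?P)"
      using wf fin by (meson finite_SigmaI finite_subset)
    show "symmetric (with_proj ?P)"
      by (auto simp: complementary_prism_def symmetric_def intro!: symI
          dest: G.arcs_symmetric C.arcs_symmetric)
    show "fst e \<noteq> snd e" if "e \<in> parcs ?P" for e
      using that by (auto simp: complementary_prism_def dest: G.no_loops' C.no_loops')
  qed (use wf fin in auto)
qed

lemma monophonic_convex_pverts: "monophonic_convex H (pverts H)"
  by (auto simp: monophonic_convex_def monophonic_path_def vpath_def vwalk_def)

lemma subset_monophonic_hull: "S \<subseteq> monophonic_hull H S"
  by (auto simp: monophonic_hull_def)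

lemma monophonic_hull_least:
  assumes "monophonic_convex H T" "S \<subseteq> T" shows "monophonic_hull H S \<subseteq> T"
  using assms by (auto simp: monophonic_hull_def)

lemma monophonic_convex_monophonic_hull:
  assumes "S \<subseteq> pverts H" shows "monophonic_convex H (monophonic_hull H S)"
proof -
  have "monophonic_hull H S \<subseteq> pverts H"
    using assms monophonic_convex_pverts by (rule monophonic_hull_least[rotated])
  moreover have "set p \<subseteq> monophonic_hull H S"
    if p: "monophonic_path H p" "hd p \<in> monophonic_hull H S" "last p \<in> monophonic_hull H S" for p
    unfolding monophonic_hull_def
  proof (rule Inter_greatest)
    fix T assume "T \<in> {T. monophonic_convex H T \<and> S \<subseteq> T}"
    then have T: "monophonic_convex H T" "monophonic_hull H S \<subseteq> T"
      using monophonic_hull_least[of H T S] by auto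
    with p show "set p \<subseteq> T"
      unfolding monophonic_convex_def by blast
  qed
  ultimately show ?thesis
    by (simp add: monophonic_convex_def)
qed

lemma m_hull_set_pverts: "m_hull_set H (pverts H)"
  by (simp add: m_hull_set_def subset_antisym subset_monophonic_hull
      monophonic_hull_least monophonic_convex_pverts)

end

(* A convex set C of the prism that meets both copies has the same trace A on each of them: if
   a is in A and b-bar is in C, append the matching edge at a to an induced path of the complement
   from b-bar to a-bar; the result is induced in the prism, so a-bar is in C, and dually.  If w is
   outside A with a neighbour a and a non-neighbour b in A, then a, w, w-bar, b-bar is induced, which
   would put w into A.  Hence, if A is proper, connectedness of the graph and of its complement yield
   outside vertices w complete and z anticomplete to A.  Given two vertices of A, one of w, z-bar is
   then the midpoint of an induced path between them.  So {u, v-bar} is a hull set for any u, v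
   distinct. *)
theory Submission
  imports Defs
begin

section \<open>Induced paths and reachability in a connected graph\<close>

lemma monophonic_path_singleton:
  assumes "pair_graph G"
  shows "monophonic_path G [x] \<longleftrightarrow> x \<in> pverts G"
proof -
  interpret pair_graph G by fact
  show ?thesis
    by (auto simp: monophonic_path_def vpath_def vwalk_def dest: no_loops')
qed

text \<open>Trades the index form of the chord condition for a recursion on the list: concrete paths
  are then checked by simplification, general ones by list induction.\<close>

lemma monophonic_path_Cons:
  assumes "pair_graph G"
  shows "monophonic_path G (x # y # p) \<longleftrightarrow>
    monophonic_path G (y # p) \<and> (x, y) \<in> parcs G \<and> x \<notin> set (y # p) \<and>
    (\<forall>z\<in>set p. (x, z) \<notin> parcs G)"
proof -
  interpret pair_graph G by fact
  have wf: "x \<in> pverts G" "y \<in> pverts G" if "(x, y) \<in> parcs G"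
    using that wellformed' by auto
  have sym: "(z, x) \<in> parcs G \<longleftrightarrow> (x, z) \<in> parcs G" for z
    using arcs_symmetric by blast
  have vpath: "vpath (x # y # p) (with_proj G) \<longleftrightarrow>
      vpath (y # p) (with_proj G) \<and> (x, y) \<in> parcs G \<and> x \<notin> set (y # p)"
    using wf by (auto simp: vpath_def vwalk_def)
  have loop: "(x, x) \<notin> parcs G"
    using no_loops' by blast
  \<comment> \<open>\<open>row\<close> and \<open>column\<close> are the chord conditions between
    \<open>x\<close> and the rest of the list; index 0 there is \<open>y\<close>, the one permitted
    neighbour.\<close>
  have row: "(\<forall>j < length (y # p). (x, (y # p) ! j) \<in> parcs G \<longrightarrow> j = 0) \<longleftrightarrow>
      (\<forall>z\<in>set p. (x, z) \<notin> parcs G)"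
    by (simp add: All_less_Suc2 all_set_conv_all_nth)
  have column: "(\<forall>i < length (y # p). ((y # p) ! i, x) \<in> parcs G \<longrightarrow> i = 0) \<longleftrightarrow>
      (\<forall>z\<in>set p. (x, z) \<notin> parcs G)"
    unfolding row[symmetric] by (simp only: sym)
  have chord: "(\<forall>i < length (x # y # p). \<forall>j < length (x # y # p).
        ((x # y # p) ! i, (x # y # p) ! j) \<in> parcs G \<longrightarrow> j = Suc i \<or> i = Suc j) \<longleftrightarrow>
      (\<forall>i < length (y # p). \<forall>j < length (y # p).
        ((y # p) ! i, (y # p) ! j) \<in> parcs G \<longrightarrow> j = Suc i \<or> i = Suc j) \<and>
      (\<forall>z\<in>set p. (x, z) \<notin> parcs G)"
    using row column loop
    unfolding length_Cons[of x] All_less_Suc2 nth_Cons_0 nth_Cons_Suc by auto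
  show ?thesis
    unfolding monophonic_path_def chord vpath by blast
qed

text \<open>If \<open>y\<close> lies on \<open>p\<close>, the suffix from \<open>y\<close> serves.
  Otherwise \<open>y\<close> is put in front of the suffix that starts at its last neighbour on
  \<open>p\<close>, so no chord at \<open>y\<close> arises.\<close>

lemma monophonic_path_attach:
  assumes G: "pair_graph G" and p: "monophonic_path G p"
    and y: "y \<in> set p \<or> (\<exists>z\<in>set p. (y, z) \<in> parcs G)"
  obtains q where "monophonic_path G q" "q \<noteq> []" "hd q = y" "last q = last p"
proof -
  have "\<exists>q. monophonic_path G q \<and> q \<noteq> [] \<and> hd q = y \<and> last q = last p"
    using p y
  proof (induction p)
    case (Cons x p)
    show ?case
    proof (cases "y = x")
      case True
      with Cons.prems show ?thesis by (intro exI[of _ "x # p"]) simp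
    next
      case yx: False
      show ?thesis
      proof (cases "y \<in> set p \<or> (\<exists>z\<in>set p. (y, z) \<in> parcs G)")
        case True
        then have "p \<noteq> []" by auto
        moreover from this have "monophonic_path G p"
          using Cons.prems(1) monophonic_path_Cons[OF G, of x "hd p" "tl p"] by simp
        ultimately show ?thesis using Cons.IH True by simp
      next
        case False
        then have "monophonic_path G (y # x # p)"
          using Cons.prems yx by (auto simp: monophonic_path_Cons[OF G])
        then show ?thesis by (intro exI[of _ "y # x # p"]) simp
      qed
    qed
  qed simp
  then show ?thesis using that by blast
qed

lemma connected_imp_reachable:
  assumes "pair_graph G" "connected (with_proj G)" "a \<in> pverts G" "b \<in> pverts G"
  shows "a \<rightarrow>\<^sup>*\<^bsub>with_proj G\<^esub> b"
proof -
  interpret pair_graph G by fact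
  have "strongly_connected (with_proj G)"
    using assms(2) by (intro symmetric_connected_imp_strongly_connected) (rule sym_arcs)
  then show ?thesis
    using assms(3,4) by (simp add: strongly_connected_def)
qed

text \<open>Induction along reachability, backwards from \<open>b\<close>: each new vertex is
  attached to an induced path already found, so no shortest path is needed.\<close>

lemma ex_monophonic_path:
  assumes G: "pair_graph G" and "connected (with_proj G)" "a \<in> pverts G" "b \<in> pverts G"
  obtains p where "monophonic_path G p" "p \<noteq> []" "hd p = a" "last p = b"
proof -
  interpret pair_graph G by fact
  have "\<exists>p. monophonic_path G p \<and> p \<noteq> [] \<and> hd p = a \<and> last p = b"
    using connected_imp_reachable[OF assms]
  proof (induction rule: converse_reachable_induct)
    case base
    then show ?case by (intro exI[of _ "[b]"]) (simp add: monophonic_path_singleton[OF G])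
  next
    case (step x y)
    then obtain p where p: "monophonic_path G p" "p \<noteq> []" "hd p = y" "last p = b"
      by blast
    moreover have "(x, hd p) \<in> parcs G" using step p by simp
    ultimately obtain q where "monophonic_path G q" "q \<noteq> []" "hd q = x" "last q = b"
      using monophonic_path_attach[OF G p(1), of x] hd_in_set[OF p(2)] by metis
    then show ?case by blast
  qed
  then show ?thesis using that by blast
qed

text \<open>Otherwise \<open>A\<close> would be closed under arcs and, by reachability, would
  contain every vertex.\<close>

lemma connected_boundary_arc:
  assumes "pair_graph G" "connected (with_proj G)" "A \<subseteq> pverts G" "A \<noteq> {}" "A \<noteq> pverts G"
  obtains a w where "a \<in> A" "w \<in> pverts G" "w \<notin> A" "(a, w) \<in> parcs G"
proof (rule ccontr)
  interpret pair_graph G by fact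
  assume no: "\<not> thesis"
  obtain a b where ab: "a \<in> A" "b \<in> pverts G" "b \<notin> A" using assms by blast
  have "a \<rightarrow>\<^sup>*\<^bsub>with_proj G\<^esub> b"
    using assms(3) ab by (intro connected_imp_reachable[OF assms(1,2)]) blast+
  then have "b \<in> A"
  proof (induction rule: reachable_induct)
    case base
    show ?case by (fact ab)
  next
    case (step x y)
    then have "(x, y) \<in> parcs G" "y \<in> pverts G" using wellformed' by auto
    with step.IH no show ?case using that by blast
  qed
  with ab show False by simp
qed

section \<open>Adjacency and induced paths in the prism\<close>

lemma complement_graph_simps:
  "pverts (complement_graph G) = pverts G"
  "(u, v) \<in> parcs (complement_graph G) \<longleftrightarrow>
    u \<in> pverts G \<and> v \<in> pverts G \<and> u \<noteq> v \<and> (u, v) \<notin> parcs G"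
  by (simp_all add: complement_graph_def)

lemma complementary_prism_simps:
  "pverts (complementary_prism G) = pverts G <+> pverts G"
  "(Inl u, Inl v) \<in> parcs (complementary_prism G) \<longleftrightarrow> (u, v) \<in> parcs G"
  "(Inr u, Inr v) \<in> parcs (complementary_prism G) \<longleftrightarrow> (u, v) \<in> parcs (complement_graph G)"
  "(Inl u, Inr v) \<in> parcs (complementary_prism G) \<longleftrightarrow> u = v \<and> u \<in> pverts G"
  "(Inr u, Inl v) \<in> parcs (complementary_prism G) \<longleftrightarrow> u = v \<and> u \<in> pverts G"
  by (auto simp: complementary_prism_def complement_graph_simps)

lemma monophonic_path_map_Inl:
  assumes "pair_graph G" "monophonic_path G p"
  shows "monophonic_path (complementary_prism G) (map Inl p)"
  using assms(2)
proof (induction p rule: induct_list012)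
  case 1
  then show ?case by (simp add: monophonic_path_def vpath_def vwalk_def)
qed (auto simp: assms(1) monophonic_path_singleton monophonic_path_Cons
      pair_graph_complementary_prism complementary_prism_simps)

lemma monophonic_path_map_Inr:
  assumes "pair_graph G" "monophonic_path (complement_graph G) p"
  shows "monophonic_path (complementary_prism G) (map Inr p)"
  using assms(2)
proof (induction p rule: induct_list012)
  case 1
  then show ?case by (simp add: monophonic_path_def vpath_def vwalk_def)
qed (auto simp: assms(1) monophonic_path_singleton monophonic_path_Cons
      pair_graph_complementary_prism pair_graph_complement_graph
      complement_graph_simps(1) complementary_prism_simps)

section \<open>Convex sets that meet both copies\<close>

lemma monophonic_convexD:
  assumes "monophonic_convex H S" "monophonic_path H p" "hd p \<in> S" "last p \<in> S" "x \<in> set p"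
  shows "x \<in> S"
  using assms unfolding monophonic_convex_def by blast

lemma convex_prism_Inl_imp_Inr:
  assumes G: "pair_graph G" and conn: "connected (with_proj (complement_graph G))"
    and C: "monophonic_convex (complementary_prism G) C"
    and a: "Inl a \<in> C" and b: "Inr b \<in> C"
  shows "Inr a \<in> C"
proof -
  note P = pair_graph_complementary_prism[OF G]
  have V: "a \<in> pverts G" "b \<in> pverts G"
    using C a b by (auto simp: monophonic_convex_def complementary_prism_simps)
  then obtain p where p: "monophonic_path (complement_graph G) p" "p \<noteq> []" "hd p = a" "last p = b"
    using ex_monophonic_path[OF pair_graph_complement_graph[OF G] conn]
    by (auto simp: complement_graph_simps)
  then obtain q where q: "p = a # q" by (cases p) auto
  have "a \<notin> set q"
    using p(1) by (simp add: q monophonic_path_def vpath_def)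
  \<comment> \<open>The only neighbour of \<open>Inl a\<close> in the other copy is
    \<open>Inr a\<close>, so a chord would need a second occurrence of \<open>a\<close> in
    \<open>p\<close>.\<close>
  then have "monophonic_path (complementary_prism G) (Inl a # map Inr p)"
    using monophonic_path_map_Inr[OF G p(1)] V
    by (auto simp: q monophonic_path_Cons[OF P] complementary_prism_simps)
  from monophonic_convexD[OF C this, of "Inr a"] show ?thesis
    using a b p by (auto simp: q last_map split: if_splits)
qed

text \<open>Mirror image of \<open>convex_prism_Inl_imp_Inr\<close>: the path now runs in
  \<open>G\<close>, whence the other connectedness hypothesis.\<close>

lemma convex_prism_Inr_imp_Inl:
  assumes G: "pair_graph G" and conn: "connected (with_proj G)"
    and C: "monophonic_convex (complementary_prism G) C"
    and a: "Inl a \<in> C" and b: "Inr b \<in> C"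
  shows "Inl b \<in> C"
proof -
  note P = pair_graph_complementary_prism[OF G]
  have V: "a \<in> pverts G" "b \<in> pverts G"
    using C a b by (auto simp: monophonic_convex_def complementary_prism_simps)
  then obtain p where p: "monophonic_path G p" "p \<noteq> []" "hd p = b" "last p = a"
    using ex_monophonic_path[OF G conn] by metis
  then obtain q where q: "p = b # q" by (cases p) auto
  have "b \<notin> set q"
    using p(1) by (simp add: q monophonic_path_def vpath_def)
  then have "monophonic_path (complementary_prism G) (Inr b # map Inl p)"
    using monophonic_path_map_Inl[OF G p(1)] V
    by (auto simp: q monophonic_path_Cons[OF P] complementary_prism_simps)
  from monophonic_convexD[OF C this, of "Inl b"] show ?thesis
    using a b p by (auto simp: q last_map split: if_splits)
qed

lemma convex_prism_eq_pverts:
  assumes G: "pair_graph G" and conn: "connected (with_proj G)"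
    and conn': "connected (with_proj (complement_graph G))"
    and C: "monophonic_convex (complementary_prism G) C"
    and u: "Inl u \<in> C" and v: "Inr v \<in> C" and uv: "u \<noteq> v"
  shows "C = pverts (complementary_prism G)"
proof -
  interpret pair_graph G by fact
  note P = pair_graph_complementary_prism[OF G]
  note simps = monophonic_path_singleton[OF P] monophonic_path_Cons[OF P]
    complementary_prism_simps complement_graph_simps
  define A where "A = {a. Inl a \<in> C}"
  have CP: "C \<subseteq> pverts G <+> pverts G"
    using C by (auto simp: monophonic_convex_def complementary_prism_simps)
  then have A: "A \<subseteq> pverts G" by (auto simp: A_def)
  have Inl: "Inl a \<in> C \<longleftrightarrow> a \<in> A" for a by (simp add: A_def)
  have Inr: "Inr a \<in> C \<longleftrightarrow> a \<in> A" for a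
    using convex_prism_Inl_imp_Inr[OF G conn' C] convex_prism_Inr_imp_Inl[OF G conn C] u v
    unfolding A_def by blast
  have uA: "u \<in> A" and vA: "v \<in> A" using u v Inl Inr by auto
  have sym: "(y, x) \<in> parcs G \<longleftrightarrow> (x, y) \<in> parcs G" for x y
    using arcs_symmetric by blast
  have homogeneous: "(w, b) \<in> parcs G"
    if "a \<in> A" "b \<in> A" "w \<in> pverts G" "w \<notin> A" "(a, w) \<in> parcs G" for a b w
  proof (rule ccontr)
    assume "(w, b) \<notin> parcs G"
    \<comment> \<open>Here \<open>a\<close> and \<open>b\<close> differ, since only \<open>a\<close>
      is adjacent to \<open>w\<close>; hence \<open>Inl a\<close> and \<open>Inr b\<close> are not
      matched.\<close>
    then have "monophonic_path (complementary_prism G) [Inl a, Inl w, Inr w, Inr b]"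
      using that A by (auto simp: simps sym[of w])
    from monophonic_convexD[OF C this, of "Inl w"] that show False
      by (simp add: Inl Inr)
  qed
  have "A = pverts G"
  proof (rule ccontr)
    assume ne: "A \<noteq> pverts G"
    show False
    \<comment> \<open>An induced path with one inner vertex needs nonadjacent ends. Exactly one of
      the two copies provides this for \<open>u\<close> and \<open>v\<close>, and the path is taken
      there.\<close>
    proof (cases "(u, v) \<in> parcs G")
      case True
      have "A \<subseteq> pverts (complement_graph G)" "A \<noteq> {}" "A \<noteq> pverts (complement_graph G)"
        using A uA ne by (auto simp: complement_graph_simps)
      from connected_boundary_arc[OF pair_graph_complement_graph[OF G] conn' this]
      obtain a z where z: "a \<in> A" "z \<in> pverts G" "z \<notin> A" "(a, z) \<notin> parcs G"
        unfolding complement_graph_simps by blast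
      \<comment> \<open>One neighbour \<open>x\<close> of \<open>z\<close> in \<open>A\<close>
        would, by \<open>homogeneous\<close>, make \<open>z\<close> adjacent to \<open>a\<close> as
        well.\<close>
      have "(x, z) \<notin> parcs G" if "x \<in> A" for x
        using homogeneous[OF that z(1-3)] z(4) sym by blast
      then have "monophonic_path (complementary_prism G) [Inr u, Inr z, Inr v]"
        using True z uv uA vA A by (auto simp: simps sym)
      from monophonic_convexD[OF C this, of "Inr z"] z uA vA show False
        by (simp add: Inr)
    next
      case False
      obtain a w where w: "a \<in> A" "w \<in> pverts G" "w \<notin> A" "(a, w) \<in> parcs G"
        using connected_boundary_arc[OF G conn A _ ne] uA by blast
      have "(w, x) \<in> parcs G" if "x \<in> A" for x
        using homogeneous[OF w(1) that w(2-4)] .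
      then have "monophonic_path (complementary_prism G) [Inl u, Inl w, Inl v]"
        using False w uv uA vA A by (auto simp: simps sym[of u w])
      from monophonic_convexD[OF C this, of "Inl w"] w uA vA show False
        by (simp add: Inl)
    qed
  qed
  then show ?thesis
    using CP Inl Inr by (auto simp: complementary_prism_simps)
qed

section \<open>Lower bound and conclusion\<close>

lemma monophonic_convex_singleton:
  assumes "x \<in> pverts H"
  shows "monophonic_convex H {x}"
  unfolding monophonic_convex_def
proof (intro conjI allI impI)
  fix p assume p: "monophonic_path H p \<and> hd p \<in> {x} \<and> last p \<in> {x}"
  \<comment> \<open>Distinctness of the vertices forces a path with equal ends to be a single
    vertex.\<close>
  then have "distinct p" "p \<noteq> []"
    by (auto simp: monophonic_path_def vpath_def vwalk_def)
  with p show "set p \<subseteq> {x}"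
    by (cases p) (auto split: if_splits)
qed (use assms in simp)

lemma card_m_hull_set_ge_2:
  assumes S: "m_hull_set H S" and "finite (pverts H)" "x \<in> pverts H" "y \<in> pverts H" "x \<noteq> y"
  shows "2 \<le> card S"
proof (rule ccontr)
  assume "\<not> 2 \<le> card S"
  \<comment> \<open>Infinite sets have \<open>card\<close> 0, so finiteness is what turns the bound
    into at most one element.\<close>
  moreover have "finite S" using assms finite_subset by (auto simp: m_hull_set_def)
  ultimately have "S = {} \<or> (\<exists>s. S = {s})"
    by (auto simp: not_le less_2_cases_iff card_1_singleton_iff)
  \<comment> \<open>For empty \<open>S\<close> the vertex \<open>x\<close> can serve as
    \<open>s\<close>.\<close>
  then obtain s where "S \<subseteq> {s}" "s \<in> pverts H"
    using S assms(3) by (auto simp: m_hull_set_def)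
  then have "monophonic_hull H S \<subseteq> {s}"
    by (intro monophonic_hull_least monophonic_convex_singleton)
  then show False using S assms(3-5) by (auto simp: m_hull_set_def)
qed

theorem theorem5p2:
  fixes G :: "'a pair_pre_digraph"
  assumes "pair_graph G"
    and "connected (with_proj G)"
    and "connected (with_proj (complement_graph G))"
  shows "monophonic_hull_number (complementary_prism G) = 2"
proof -
  let ?P = "complementary_prism G"
  interpret pair_graph G by fact
  obtain u where u: "u \<in> pverts G"
    using assms(2) by (auto simp: connected_conv)
  have "\<exists>S. m_hull_set ?P S \<and> card S = 2"
  \<comment> \<open>The one-vertex graph satisfies the hypotheses but has no two distinct vertices;
    its prism is a single edge, and both ends together form the hull set.\<close>
  proof (cases "pverts G = {u}")
    case True
    then have "pverts ?P = {Inl u, Inr u}" by (auto simp: complementary_prism_simps)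
    then show ?thesis using m_hull_set_pverts[of ?P] by (intro exI[of _ "pverts ?P"]) simp
  next
    case False
    with u obtain v where v: "v \<in> pverts G" "u \<noteq> v" by blast
    let ?S = "{Inl u, Inr v}"
    have "?S \<subseteq> pverts ?P" using u v by (auto simp: complementary_prism_simps)
    then have "m_hull_set ?P ?S"
      using convex_prism_eq_pverts[OF assms monophonic_convex_monophonic_hull[of ?S ?P], of u v]
        subset_monophonic_hull[of ?S ?P] v
      by (simp add: m_hull_set_def)
    then show ?thesis by (intro exI[of _ ?S]) simp
  qed
  moreover have "2 \<le> card S" if "m_hull_set ?P S" for S
    using that u
    by (intro card_m_hull_set_ge_2[of ?P S "Inl u" "Inr u"])
      (auto simp: complementary_prism_simps)
  ultimately show ?thesis
    unfolding monophonic_hull_number_def by (intro Least_equality) auto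
qed

end
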